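(* If the system of total differential equations (T) has an $(s_1,s_2)$-nonautonomous $(n-k_1,n-k_2)$-cylindricality $\mathbb R$-differentiable first integral $F\colon(z,w)\mapsto F({}^sz,{}^kw)$ on $G'$ (of the form described in the context), then for every variable $\chi$ in the list $\mathcal V$ and all $(z,w)\in G$, $$W_\chi\bigl(1,{}^\lambda X^\theta(z,w)\bigr)=0,\ \theta=1,\dots,s_1,\qquad W_\chi\bigl({}^\lambda X^\eta(z,w)\bigr)=0,\ \eta=s_1+1,\dots,m,$$ $$W_\chi\bigl(1,{}^\lambda X^{m+j_g}(z,w)\bigr)=0,\ g=1,\dots,s_2,\qquad W_\chi\bigl({}^\lambda X^{m+j_\nu}(z,w)\bigr)=0,\ \nu=s_2+1,\dots,m.$$
   Context: Setting. $G\subset\mathbb C^{m+n}$ is a domain with points $(z,w)$, $z=(z_1,\dots,z_m)$, $w=(w_1,\dots,w_n)$, and $G'\subset G$ is a subdomain. $\mathbb R$-differentiable means differentiable as a function of the real and imaginary parts of the variables (all higher derivatives that appear are assumed to exist); $\partial_{z_j},\partial_{\overline z_j},\partial_{w_\xi},\partial_{\overline w_\xi}$ are Wirtinger derivatives; bars over functions denote complex conjugation. System (T) is $$dw_\xi=\sum_{j=1}^m\bigl(X_{\xi j}(z,w)\,dz_j+X_{\xi,m+j}(z,w)\,d\overline z_j\bigr),\quad \xi=1,\dots,n,\tag{T}$$ with $\mathbb R$-differentiable $X_{\xi l}\colon G\to\mathbb C$. Put, for $j=1,\dots,m$, $\mathfrak X_j=\partial_{z_j}+\sum_{\xi=1}^n(X_{\xi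 j}\partial_{w_\xi}+\overline X_{\xi,m+j}\partial_{\overline w_\xi})$ and $\mathfrak X_{m+j}=\partial_{\overline z_j}+\sum_{\xi=1}^n(X_{\xi,m+j}\partial_{w_\xi}+\overline X_{\xi j}\partial_{\overline w_\xi})$. A (non-constant) $\mathbb R$-differentiable function $F\colon G'\to\mathbb C$ is a first integral of (T) if $\mathfrak X_lF=0$ on $G'$, $l=1,\dots,2m$. Form of the functions. Fix integers $0\le s_1,s_2\le m$, $0\le k_1,k_2\le n$, a permutation $(j_1,\dots,j_m)$ of $(1,\dots,m)$ and a permutation $(\zeta_1,\dots,\zeta_n)$ of $(1,\dots,n)$. An $(s_1,s_2)$-nonautonomous $(n-k_1,n-k_2)$-cylindricality function $F({}^sz,{}^kw)$ is an $\mathbb R$-differentiable function on $G'$ that is antiholomorphic in $z_{s_1+1},\dots,z_m,w_{k_1+1},\dots,w_n$ and holomorphic in $z_{j_{s_2+1}},\dots,z_{j_m},w_{\zeta_{k_2+1}},\dots,w_{\zeta_n}$, i.e. $\partial_\chi F=0$ for every $\chi$ in the list $$\mathcal V=\{z_\alpha\ (\alpha>s_1),\ \overline z_{j_\beta}\ (\beta>s_2),\ w_\gamma\ (\gamma>k_1),\ \overline w_{\zeta_\delta}\ (\delta>k_2)\}.$$ Notation. $\lambda=k_1+k_2$; for $j=1,\dots,m$, $${}^\lambda X^j=(X_{1j},\dots,X_{k_1j},\overline X_{\zeta_1,m+j},\dots,\overline X_{\zeta_{k_2},m+j}),\quad {}^\lambda X^{m+j}=(X_{1,m+j},\dots,X_{k_1,m+j},\overline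 X_{\zeta_1j},\dots,\overline X_{\zeta_{k_2}j}).$$ $W_\chi(u_1,\dots,u_p)=\det(\partial_\chi^{\,i-1}u_k)_{i,k=1}^p$ is the Wronskian with respect to $\chi$.
   Formalization: The identities are proved for all (z,w) in G in the closure of the points of G' where dF ≠ 0, not on all of G; with smooth data they can fail elsewhere (outside G', or where F is locally constant). F is taken C^1 and the coefficients C^(k1+k2). *)

theory Defs
  imports "HOL-Analysis.Analysis" "Jordan_Normal_Form.Determinant"
begin

text \<open>Points \<open>(z, w)\<close> live in \<open>(complex ^ 'm) \<times> (complex ^ 'n)\<close>, with \<open>m = CARD('m)\<close> and
  \<open>n = CARD('n)\<close>. All indices are natural numbers counted from 1; \<open>nth_index i\<close> is the i-th
  element of the finite index type in a fixed numbering \<open>{1..CARD('a)} \<rightarrow> UNIV\<close> (a bijection).\<close>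

definition nth_index :: "nat \<Rightarrow> 'a::finite" where
  "nth_index i = from_nat_into UNIV (i - 1)"

datatype variable = Z nat | Zbar nat | W nat | Wbar nat

fun variable_vec :: "variable \<Rightarrow> complex \<Rightarrow> (complex ^ 'm) \<times> (complex ^ 'n)" where
  "variable_vec (Z i) c = (axis (nth_index i) c, 0)"
| "variable_vec (Zbar i) c = (axis (nth_index i) c, 0)"
| "variable_vec (W i) c = (0, axis (nth_index i) c)"
| "variable_vec (Wbar i) c = (0, axis (nth_index i) c)"

fun barred :: "variable \<Rightarrow> bool" where
  "barred (Z i) = False"
| "barred (Zbar i) = True"
| "barred (W i) = False"
| "barred (Wbar i) = True"

text \<open>Wirtinger derivatives: \<open>(\<partial>\<^sub>x - \<i> \<partial>\<^sub>y) / 2\<close> for an unbarred and \<open>(\<partial>\<^sub>x + \<i> \<partial>\<^sub>y) / 2\<close> for a barred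
  variable. They are meaningful at points of real (Frechet) differentiability.\<close>

definition wirtinger ::
  "variable \<Rightarrow> ((complex ^ 'm) \<times> (complex ^ 'n) \<Rightarrow> complex) \<Rightarrow> (complex ^ 'm) \<times> (complex ^ 'n) \<Rightarrow> complex"
  where
  "wirtinger x f p =
     (let D = frechet_derivative f (at p);
          Dx = D (variable_vec x 1); Dy = D (variable_vec x \<i>)
      in if barred x then (Dx + \<i> * Dy) / 2 else (Dx - \<i> * Dy) / 2)"

text \<open>Continuous real differentiability up to order \<open>k\<close> on an open set.\<close>

fun R_differentiable ::
  "nat \<Rightarrow> ('a::real_normed_vector \<Rightarrow> 'b::real_normed_vector) \<Rightarrow> 'a set \<Rightarrow> bool" where
  "R_differentiable 0 f S \<longleftrightarrow> continuous_on S f"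
| "R_differentiable (Suc k) f S \<longleftrightarrow>
     f differentiable_on S \<and> (\<forall>v. R_differentiable k (\<lambda>p. frechet_derivative f (at p) v) S)"

text \<open>The system enters through its coefficients \<open>X \<xi> l\<close>, \<open>1 \<le> \<xi> \<le> n\<close>, \<open>1 \<le> l \<le> 2m\<close>:
  \<open>X \<xi> j\<close> is the coefficient of \<open>dz\<^sub>j\<close> and \<open>X \<xi> (m + j)\<close> that of the differential of the
  conjugate of \<open>z\<^sub>j\<close>, for \<open>1 \<le> j \<le> m\<close>. \<open>conj_index m\<close> swaps \<open>j\<close> and \<open>m + j\<close>; \<open>differential m l\<close> is
  the variable whose differential is the l-th one.\<close>

definition conj_index :: "nat \<Rightarrow> nat \<Rightarrow> nat" where
  "conj_index m l = (if l \<le> m then m + l else l - m)"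

definition differential :: "nat \<Rightarrow> nat \<Rightarrow> variable" where
  "differential m l = (if l \<le> m then Z l else Zbar (l - m))"

definition system_operator ::
  "(nat \<Rightarrow> nat \<Rightarrow> (complex ^ 'm) \<times> (complex ^ 'n) \<Rightarrow> complex) \<Rightarrow> nat \<Rightarrow>
   ((complex ^ 'm) \<times> (complex ^ 'n) \<Rightarrow> complex) \<Rightarrow> (complex ^ 'm) \<times> (complex ^ 'n) \<Rightarrow> complex"
  where
  "system_operator X l F p =
     wirtinger (differential CARD('m) l) F p +
     (\<Sum>\<xi> = 1..CARD('n). X \<xi> l p * wirtinger (W \<xi>) F p +
        cnj (X \<xi> (conj_index CARD('m) l) p) * wirtinger (Wbar \<xi>) F p)"

definition first_integral ::
  "(nat \<Rightarrow> nat \<Rightarrow> (complex ^ 'm) \<times> (complex ^ 'n) \<Rightarrow> complex) \<Rightarrow>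
   ((complex ^ 'm) \<times> (complex ^ 'n)) set \<Rightarrow> ((complex ^ 'm) \<times> (complex ^ 'n) \<Rightarrow> complex) \<Rightarrow> bool"
  where
  "first_integral X D F \<longleftrightarrow>
     R_differentiable 1 F D \<and> \<not> F constant_on D \<and>
     (\<forall>l \<in> {1..2 * CARD('m)}. \<forall>p \<in> D. system_operator X l F p = 0)"

text \<open>The variables that a cylindricality function does not depend on.\<close>

definition absent_variables ::
  "nat \<Rightarrow> nat \<Rightarrow> nat \<Rightarrow> nat \<Rightarrow> nat \<Rightarrow> nat \<Rightarrow> (nat \<Rightarrow> nat) \<Rightarrow> (nat \<Rightarrow> nat) \<Rightarrow> variable set" where
  "absent_variables m n s1 s2 k1 k2 j \<zeta> =
     Z ` {s1<..m} \<union> (\<lambda>\<beta>. Zbar (j \<beta>)) ` {s2<..m} \<union>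
     W ` {k1<..n} \<union> (\<lambda>\<delta>. Wbar (\<zeta> \<delta>)) ` {k2<..n}"

definition cylindricality ::
  "nat \<Rightarrow> nat \<Rightarrow> nat \<Rightarrow> nat \<Rightarrow> (nat \<Rightarrow> nat) \<Rightarrow> (nat \<Rightarrow> nat) \<Rightarrow>
   ((complex ^ 'm) \<times> (complex ^ 'n)) set \<Rightarrow> ((complex ^ 'm) \<times> (complex ^ 'n) \<Rightarrow> complex) \<Rightarrow> bool"
  where
  "cylindricality s1 s2 k1 k2 j \<zeta> D F \<longleftrightarrow>
     R_differentiable 1 F D \<and>
     (\<forall>x \<in> absent_variables CARD('m) CARD('n) s1 s2 k1 k2 j \<zeta>. \<forall>p \<in> D. wirtinger x F p = 0)"

text \<open>For \<open>l = i\<close> and \<open>l = m + i\<close> with \<open>1 \<le> i \<le> m\<close> this is the vector of functions with upper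
  left index \<open>\<lambda> = k1 + k2\<close> and upper right index \<open>l\<close>.\<close>

definition coeff_vector ::
  "(nat \<Rightarrow> nat \<Rightarrow> (complex ^ 'm) \<times> (complex ^ 'n) \<Rightarrow> complex) \<Rightarrow> nat \<Rightarrow> nat \<Rightarrow> (nat \<Rightarrow> nat) \<Rightarrow> nat \<Rightarrow>
   ((complex ^ 'm) \<times> (complex ^ 'n) \<Rightarrow> complex) list" where
  "coeff_vector X k1 k2 \<zeta> l =
     map (\<lambda>\<xi>. X \<xi> l) [1..<Suc k1] @
     map (\<lambda>\<delta> p. cnj (X (\<zeta> \<delta>) (conj_index CARD('m) l) p)) [1..<Suc k2]"

definition wronskian ::
  "variable \<Rightarrow> ((complex ^ 'm) \<times> (complex ^ 'n) \<Rightarrow> complex) list \<Rightarrow>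
   (complex ^ 'm) \<times> (complex ^ 'n) \<Rightarrow> complex" where
  "wronskian x us p =
     Determinant.det (Matrix.mat (length us) (length us)
       (\<lambda>(i, k). (wirtinger x ^^ i) (us ! k) p))"

text \<open>Where \<open>F\<close> is locally constant, or undefined, a first integral \<open>F\<close> puts no constraint on the
  coefficients. The points of the closure of this set are those at which it does.\<close>

definition noncritical_points ::
  "('a::real_normed_vector \<Rightarrow> 'b::real_normed_vector) \<Rightarrow> 'a set \<Rightarrow> 'a set" where
  "noncritical_points F D = {p \<in> D. frechet_derivative F (at p) \<noteq> (\<lambda>v. 0)}"

end

theory Submission
  imports Defs "HOL-Complex_Analysis.Cauchy_Integral_Formula"
begin

text \<open>
  Fix an absent variable \<open>\<chi>\<close>. Since \<open>\<partial>\<^sub>\<chi> F = 0\<close>, on every complex line in the direction of \<open>\<chi>\<close>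
  the function \<open>F\<close> is holomorphic, after conjugating the parameter of the line if \<open>\<chi>\<close> is
  unbarred. All first derivatives \<open>\<phi>\<close> of \<open>F\<close> inherit this, so that formally
  \<open>\<partial>\<^sub>\<chi> \<phi> = 0\<close>: they are constants for the operator \<open>\<partial>\<^sub>\<chi>\<close>. For each \<open>l\<close> the equation of
  the system is a linear relation \<open>\<phi>\<^sub>0 + (\<Sum>k. u\<^sub>k \<phi>\<^sub>k) = 0\<close>, where the \<open>u\<^sub>k\<close> are the entries of the
  coefficient vector, the \<open>\<phi>\<^sub>k\<close> are the derivatives of \<open>F\<close> in the corresponding variables \<open>w\<close> and
  conjugates of \<open>w\<close>, and \<open>\<phi>\<^sub>0\<close> is the derivative in the variable numbered \<open>l\<close> among the \<open>z\<close> and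
  their conjugates; \<open>\<phi>\<^sub>0\<close> vanishes if that variable is absent. Applying \<open>\<partial>\<^sub>\<chi>\<close> repeatedly turns
  this one relation into as many as there are rows in the Wronskian matrix of \<open>1, u\<^sub>1, u\<^sub>2, \<dots>\<close>, or of
  \<open>u\<^sub>1, u\<^sub>2, \<dots>\<close> if \<open>\<phi>\<^sub>0 = 0\<close>. So \<open>\<phi>\<close> is in the kernel of that matrix.

  The kernel vector is nonzero where the differential of \<open>F\<close> is: if all \<open>\<phi>\<^sub>k\<close> with \<open>k \<ge> 1\<close> vanish
  at a point, then so do all derivatives of \<open>F\<close> in the \<open>w\<close> and their conjugates, hence by the
  system also those in the \<open>z\<close> and their conjugates (\<open>w_gradient_nonzero\<close>). Therefore
  the Wronskian vanishes at the noncritical points, and by continuity on their closure in \<open>G\<close>.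

  The delicate point is that \<open>F\<close> has just one continuous derivative, so that the \<open>\<phi>\<^sub>k\<close> are merely
  continuous and \<open>\<partial>\<^sub>\<chi> \<phi>\<^sub>k = 0\<close> cannot come from exchanging second derivatives. On a line in the
  direction of \<open>\<chi>\<close>, however, \<open>\<phi>\<^sub>k\<close> is a locally uniform limit of difference quotients of \<open>F\<close>,
  which are holomorphic there (\<open>holomorphic_directional_derivative\<close>). Accordingly, \<open>\<partial>\<^sub>\<chi>\<close> is applied
  to the relations in the sense of \<open>has_wirtinger\<close>, which asks for differentiability
  along the line alone and still has the product rule.
\<close>


section \<open>Differentiability classes\<close>

lemma frechet_derivative_cong_open:
  assumes "open S" "p \<in> S" "\<And>q. q \<in> S \<Longrightarrow> f q = g q"
  shows "frechet_derivative f (at p) = frechet_derivative g (at p)"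
proof -
  have "(f has_derivative D) (at p) \<longleftrightarrow> (g has_derivative D) (at p)" for D
    using has_derivative_transform_within_open[OF _ assms(1,2)] assms(3) by metis
  then show ?thesis
    by (simp add: frechet_derivative_def)
qed

lemma R_differentiable_imp_differentiable:
  assumes "R_differentiable (Suc k) f S" "open S" "p \<in> S"
  shows "(f has_derivative frechet_derivative f (at p)) (at p)"
  using assms by (simp add: differentiable_on_eq_differentiable_at frechet_derivative_works[symmetric])

lemma R_differentiable_imp_continuous_on:
  "R_differentiable k f S \<Longrightarrow> continuous_on S f"
  by (cases k) (auto intro: differentiable_imp_continuous_on)

lemma R_differentiable_cong:
  assumes "open S" "R_differentiable k f S" "\<And>q. q \<in> S \<Longrightarrow> f q = g q"
  shows "R_differentiable k g S"
  using assms(2,3)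
proof (induction k arbitrary: f g)
  case 0
  then show ?case
    using continuous_on_eq by auto
next
  case (Suc k)
  have "g differentiable_on S"
    unfolding differentiable_on_def
    using Suc.prems has_derivative_transform[of _ S g f]
    by (metis R_differentiable.simps(2) differentiable_def differentiable_on_def)
  moreover have "R_differentiable k (\<lambda>p. frechet_derivative g (at p) v) S" for v
    using Suc.IH[of "\<lambda>p. frechet_derivative f (at p) v"] Suc.prems
      frechet_derivative_cong_open[OF assms(1), of _ f g] by auto
  ultimately show ?case by simp
qed

lemma R_differentiable_subset:
  "R_differentiable k f S \<Longrightarrow> T \<subseteq> S \<Longrightarrow> R_differentiable k f T"
  by (induction k arbitrary: f) (auto intro: continuous_on_subset differentiable_on_subset)

lemma R_differentiable_const: "R_differentiable k (\<lambda>_. c) S"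
  by (induction k arbitrary: c) auto

lemma R_differentiable_bounded_linear:
  assumes "open S" "bounded_linear A" "R_differentiable k f S"
  shows "R_differentiable k (\<lambda>p. A (f p)) S"
  using assms(3)
proof (induction k arbitrary: f)
  case 0
  then show ?case
    using bounded_linear.continuous_on[OF assms(2)] by auto
next
  case (Suc k)
  have D: "((\<lambda>p. A (f p)) has_derivative (\<lambda>v. A (frechet_derivative f (at p) v))) (at p)" if "p \<in> S" for p
    using bounded_linear.has_derivative[OF assms(2)]
      R_differentiable_imp_differentiable[OF Suc.prems assms(1) that] by blast
  then have "(\<lambda>p. A (f p)) differentiable_on S"
    unfolding differentiable_on_def differentiable_def
    using has_derivative_at_withinI by blast
  moreover have "R_differentiable k (\<lambda>p. frechet_derivative (\<lambda>p. A (f p)) (at p) v) S" for v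
  proof (rule R_differentiable_cong[OF assms(1)])
    show "R_differentiable k (\<lambda>p. A (frechet_derivative f (at p) v)) S"
      using Suc.prems by (intro Suc.IH) simp
    show "A (frechet_derivative f (at p) v) = frechet_derivative (\<lambda>p. A (f p)) (at p) v" if "p \<in> S" for p
      by (simp add: frechet_derivative_at[OF D[OF that], symmetric])
  qed
  ultimately show ?case by simp
qed

lemma R_differentiable_add:
  assumes "open S" "R_differentiable k f S" "R_differentiable k g S"
  shows "R_differentiable k (\<lambda>p. f p + g p) S"
  using assms(2,3)
proof (induction k arbitrary: f g)
  case 0
  then show ?case
    by (auto intro: continuous_on_add)
next
  case (Suc k)
  have D: "((\<lambda>p. f p + g p) has_derivative
      (\<lambda>v. frechet_derivative f (at p) v + frechet_derivative g (at p) v)) (at p)" if "p \<in> S" for p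
    using R_differentiable_imp_differentiable[OF _ assms(1) that] Suc.prems has_derivative_add by blast
  have "(\<lambda>p. f p + g p) differentiable_on S"
    using Suc.prems by auto
  moreover have "R_differentiable k (\<lambda>p. frechet_derivative (\<lambda>p. f p + g p) (at p) v) S" for v
  proof (rule R_differentiable_cong[OF assms(1)])
    show "R_differentiable k (\<lambda>p. frechet_derivative f (at p) v + frechet_derivative g (at p) v) S"
      using Suc.prems by (intro Suc.IH) simp_all
    show "frechet_derivative f (at p) v + frechet_derivative g (at p) v =
        frechet_derivative (\<lambda>p. f p + g p) (at p) v" if "p \<in> S" for p
      by (simp add: frechet_derivative_at[OF D[OF that], symmetric])
  qed
  ultimately show ?case by simp
qed

section \<open>Wirtinger derivatives along complex lines\<close>

text \<open>Conjugating the parameter for an unbarred variable makes every Wirtinger derivative the operator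
  \<open>(\<partial>\<^sub>x + \<i> \<partial>\<^sub>y) / 2\<close> in the parameter \<open>x + \<i> y\<close> of this line, so that barred and unbarred variables
  need no separate treatment and a vanishing Wirtinger derivative always means holomorphy.\<close>

definition variable_line :: "variable \<Rightarrow> complex \<Rightarrow> (complex ^ 'm) \<times> (complex ^ 'n)" where
  "variable_line x c = variable_vec x (if barred x then c else cnj c)"

lemma bounded_linear_axis: "bounded_linear (axis i :: complex \<Rightarrow> complex ^ 'n)"
  unfolding linear_conv_bounded_linear[symmetric]
  by (rule linearI) (simp_all add: axis_def Finite_Cartesian_Product.vec_eq_iff)

lemma bounded_linear_variable_vec:
  "bounded_linear (variable_vec x :: complex \<Rightarrow> (complex ^ 'm) \<times> (complex ^ 'n))"
proof -
  have "variable_vec (Z i) = (\<lambda>c. (axis (nth_index i) c, 0) :: (complex ^ 'm) \<times> (complex ^ 'n))"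
    "variable_vec (Zbar i) = (\<lambda>c. (axis (nth_index i) c, 0) :: (complex ^ 'm) \<times> (complex ^ 'n))"
    "variable_vec (W i) = (\<lambda>c. (0, axis (nth_index i) c) :: (complex ^ 'm) \<times> (complex ^ 'n))"
    "variable_vec (Wbar i) = (\<lambda>c. (0, axis (nth_index i) c) :: (complex ^ 'm) \<times> (complex ^ 'n))" for i
    by (auto simp: fun_eq_iff)
  then show ?thesis
    by (cases x) (simp_all add: bounded_linear_Pair bounded_linear_axis)
qed

lemma bounded_linear_variable_line: "bounded_linear (variable_line x)"
proof (cases "barred x")
  case True
  then show ?thesis
    using bounded_linear_variable_vec by (simp add: variable_line_def[abs_def])
next
  case False
  then show ?thesis
    using bounded_linear_compose[OF bounded_linear_variable_vec bounded_linear_cnj]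
    by (simp add: variable_line_def[abs_def])
qed

lemma bounded_linear_frechet_derivative:
  "f differentiable at p \<Longrightarrow> bounded_linear (frechet_derivative f (at p))"
  using frechet_derivative_works has_derivative_bounded_linear by blast

lemma wirtinger_eq_dbar:
  fixes f :: "(complex ^ 'm) \<times> (complex ^ 'n) \<Rightarrow> complex"
  assumes "f differentiable at p"
  shows "wirtinger x f p = (frechet_derivative f (at p) (variable_line x 1) +
    \<i> * frechet_derivative f (at p) (variable_line x \<i>)) / 2"
proof -
  let ?D = "frechet_derivative f (at p)"
  have "variable_vec x (- \<i>) = - (variable_vec x \<i> :: (complex ^ 'm) \<times> (complex ^ 'n))"
    using linear_neg[OF bounded_linear.linear[OF bounded_linear_variable_vec]] by blast
  moreover have "?D (- variable_vec x \<i>) = - ?D (variable_vec x \<i>)"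
    using linear_neg[OF bounded_linear.linear[OF bounded_linear_frechet_derivative[OF assms]]] by blast
  ultimately have "?D (variable_vec x (- \<i>)) = - ?D (variable_vec x \<i>)"
    by (rule subst[OF sym])
  then show ?thesis
    by (simp add: wirtinger_def Let_def variable_line_def)
qed

text \<open>A Wirtinger derivative that exists even where \<open>f\<close> is differentiable along the line of the
  variable \<open>x\<close> only, as is the case for the first derivatives of a first integral.\<close>

definition has_wirtinger ::
  "variable \<Rightarrow> ((complex ^ 'm) \<times> (complex ^ 'n) \<Rightarrow> complex) \<Rightarrow> complex \<Rightarrow>
   (complex ^ 'm) \<times> (complex ^ 'n) \<Rightarrow> bool" where
  "has_wirtinger x f d p \<longleftrightarrow>
     (\<exists>D. ((\<lambda>c. f (p + variable_line x c)) has_derivative D) (at 0) \<and> d = (D 1 + \<i> * D \<i>) / 2)"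

lemma variable_line_0 [simp]: "variable_line x 0 = 0"
  using bounded_linear_variable_line linear_0 bounded_linear.linear by blast

lemma has_wirtinger_unique:
  "has_wirtinger x f d p \<Longrightarrow> has_wirtinger x f e p \<Longrightarrow> d = e"
  unfolding has_wirtinger_def using has_derivative_unique by blast

lemma has_derivative_along_line:
  fixes L :: "'a::real_normed_vector \<Rightarrow> 'b::real_normed_vector"
  assumes "bounded_linear L" "(f has_derivative D) (at (p + L c))"
  shows "((\<lambda>c. f (p + L c)) has_derivative (\<lambda>h. D (L h))) (at c)"
proof -
  have "((\<lambda>c. p + L c) has_derivative L) (at c)"
    using has_derivative_add[OF has_derivative_const bounded_linear_imp_has_derivative[OF assms(1)]]
    by simp
  then show ?thesis
    using has_derivative_compose assms(2) by fastforce
qed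

lemma differentiable_imp_has_wirtinger:
  assumes "f differentiable at p"
  shows "has_wirtinger x f (wirtinger x f p) p"
  unfolding has_wirtinger_def
proof (intro exI conjI)
  show "((\<lambda>c. f (p + variable_line x c)) has_derivative
      (\<lambda>h. frechet_derivative f (at p) (variable_line x h))) (at 0)"
    using assms by (intro has_derivative_along_line bounded_linear_variable_line)
      (simp add: frechet_derivative_works[symmetric])
qed (rule wirtinger_eq_dbar[OF assms])

lemma has_wirtinger_const: "has_wirtinger x (\<lambda>_. a) 0 p"
  unfolding has_wirtinger_def by (rule exI[of _ "\<lambda>_. 0"]) simp

lemma has_wirtinger_add:
  "has_wirtinger x f d p \<Longrightarrow> has_wirtinger x g e p \<Longrightarrow> has_wirtinger x (\<lambda>q. f q + g q) (d + e) p"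
  unfolding has_wirtinger_def
  by (elim exE conjE, rule exI, rule conjI, erule (1) has_derivative_add) (simp add: field_simps)

lemma has_wirtinger_mult:
  "has_wirtinger x f d p \<Longrightarrow> has_wirtinger x g e p \<Longrightarrow>
    has_wirtinger x (\<lambda>q. f q * g q) (d * g p + f p * e) p"
  unfolding has_wirtinger_def
  by (elim exE conjE, rule exI, rule conjI, erule (1) has_derivative_mult)
    (simp add: add_divide_distrib ring_distribs mult_ac)

lemma has_wirtinger_sum:
  "(\<And>k. k \<in> K \<Longrightarrow> has_wirtinger x (f k) (d k) p) \<Longrightarrow>
    has_wirtinger x (\<lambda>q. \<Sum>k\<in>K. f k q) (\<Sum>k\<in>K. d k) p"
  by (induction K rule: infinite_finite_induct) (auto simp: has_wirtinger_const intro!: has_wirtinger_add)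

lemma has_wirtinger_transform:
  assumes "has_wirtinger x f d p" "open S" "p \<in> S" "\<And>q. q \<in> S \<Longrightarrow> f q = g q"
  shows "has_wirtinger x g d p"
proof -
  let ?T = "(\<lambda>c. p + variable_line x c) -` S"
  have T: "open ?T"
    by (intro open_vimage[OF assms(2)] continuous_intros
        bounded_linear.continuous_on[OF bounded_linear_variable_line])
  have 0: "0 \<in> ?T"
    using assms(3) by simp
  obtain D where D: "((\<lambda>c. f (p + variable_line x c)) has_derivative D) (at 0)"
    "d = (D 1 + \<i> * D \<i>) / 2"
    using assms(1) unfolding has_wirtinger_def by blast
  have "((\<lambda>c. g (p + variable_line x c)) has_derivative D) (at 0)"
    by (rule has_derivative_transform_within_open[OF D(1) T 0]) (simp add: assms(4))
  then show ?thesis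
    unfolding has_wirtinger_def using D(2) by blast
qed

lemma R_differentiable_wirtinger:
  fixes S :: "((complex ^ 'm) \<times> (complex ^ 'n)) set"
  assumes "open S" "R_differentiable (Suc k) f S"
  shows "R_differentiable k (wirtinger x f) S"
proof (rule R_differentiable_cong[OF assms(1)])
  show "R_differentiable k (\<lambda>p. 1 / 2 * frechet_derivative f (at p) (variable_line x 1) +
      \<i> / 2 * frechet_derivative f (at p) (variable_line x \<i>)) S"
    using assms
    by (intro R_differentiable_add R_differentiable_bounded_linear[OF _ bounded_linear_mult_right])
      (simp_all del: split_paired_All)
  show "1 / 2 * frechet_derivative f (at p) (variable_line x 1) +
      \<i> / 2 * frechet_derivative f (at p) (variable_line x \<i>) = wirtinger x f p" if "p \<in> S" for p
    using assms differentiable_on_eq_differentiable_at that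
    by (subst wirtinger_eq_dbar) (auto simp: field_simps)
qed

lemma R_differentiable_wirtinger_funpow:
  fixes S :: "((complex ^ 'm) \<times> (complex ^ 'n)) set"
  assumes "open S" "R_differentiable d f S" "i \<le> d"
  shows "R_differentiable (d - i) ((wirtinger x ^^ i) f) S"
  using assms(3)
proof (induction i)
  case 0
  then show ?case using assms by simp
next
  case (Suc i)
  then have "R_differentiable (Suc (d - Suc i)) ((wirtinger x ^^ i) f) S"
    by (simp add: Suc_diff_Suc)
  then show ?case
    using R_differentiable_wirtinger[OF assms(1)] by simp
qed

section \<open>Derivatives of a cylindricality function along an absent variable\<close>

text \<open>The difference quotients of \<open>F\<close> in the direction \<open>v\<close> are holomorphic on the complex line
  through \<open>p\<close> along \<open>L\<close>, because \<open>F\<close> satisfies the Cauchy-Riemann equations there. By the mean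
  value theorem and the uniform continuity of the derivative they converge uniformly near \<open>p\<close> to
  the derivative in the direction \<open>v\<close>, which is therefore holomorphic on the line.\<close>

lemma holomorphic_directional_derivative:
  fixes F :: "'a::real_normed_vector \<Rightarrow> complex" and L :: "complex \<Rightarrow> 'a"
  assumes "open S" "p \<in> S" "bounded_linear L" "F differentiable_on S"
    and cont: "continuous_on S (\<lambda>q. frechet_derivative F (at q) v)"
    and CR: "\<And>q. q \<in> S \<Longrightarrow>
      frechet_derivative F (at q) (L \<i>) = \<i> * frechet_derivative F (at q) (L 1)"
  obtains r where "r > 0" "(\<lambda>c. frechet_derivative F (at (p + L c)) v) holomorphic_on ball 0 r"
proof -
  interpret L: bounded_linear L by fact
  \<comment> \<open>The line through \<open>p\<close>, translated by \<open>s\<close> in the direction \<open>v\<close>; it stays in \<open>S\<close> for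
    parameters up to \<open>r\<close>.\<close>
  define h where "h = (\<lambda>cs. p + L (fst cs) + snd cs *\<^sub>R v)"
  have h_cont: "continuous_on T h" for T
    unfolding h_def by (intro continuous_intros L.continuous_on)
  have "open (h -` S)"
    using continuous_on_open_vimage[OF open_UNIV, of h] h_cont assms(1) by auto
  moreover have "(0, 0) \<in> h -` S"
    using assms(2) by (simp add: h_def L.zero)
  ultimately obtain A B where AB: "open A" "open B" "(0, 0) \<in> A \<times> B" "A \<times> B \<subseteq> h -` S"
    by (rule open_prod_elim)
  obtain a where a: "a > 0" "cball 0 a \<subseteq> A"
    using AB open_contains_cball by blast
  obtain b where b: "b > 0" "cball 0 b \<subseteq> B"
    using AB open_contains_cball by blast
  define r where "r = min a b"
  have r: "r > 0"
    using a b by (simp add: r_def)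
  have hS: "h (c, s) \<in> S" if "c \<in> cball 0 r" "s \<in> {0..r}" for c s
  proof -
    have "(c, s) \<in> A \<times> B"
      using that a b by (force simp: r_def)
    then show ?thesis using AB by blast
  qed
  have D: "(F has_derivative frechet_derivative F (at q)) (at q)" if "q \<in> S" for q
    using assms(1,4) that by (simp add: differentiable_on_eq_differentiable_at frechet_derivative_works[symmetric])
  define \<psi> where "\<psi> = (\<lambda>cs. frechet_derivative F (at (h cs)) v)"
  have "continuous_on (cball 0 r \<times> {0..r}) \<psi>"
    unfolding \<psi>_def using hS
    by (intro continuous_on_compose2[OF cont h_cont]) auto
  then have uc: "uniformly_continuous_on (cball 0 r \<times> {0..r}) \<psi>"
    by (intro compact_uniformly_continuous compact_Times) auto
  have hol: "(\<lambda>c. F (h (c, s))) holomorphic_on ball 0 r" if "s \<in> {0..r}" for s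
  proof (rule holomorphic_onI)
    fix c :: complex assume "c \<in> ball 0 r"
    then have S: "h (c, s) \<in> S"
      using hS that by simp
    let ?D = "frechet_derivative F (at (h (c, s)))"
    interpret D: bounded_linear ?D
      using D[OF S] by (rule has_derivative_bounded_linear)
    have lin: "(\<lambda>k. ?D (L k)) = (*) (?D (L 1))"
    proof
      fix k
      have "Re k *\<^sub>R 1 + Im k *\<^sub>R \<i> = k"
        by (simp add: complex_eq_iff)
      moreover have "?D (L (Re k *\<^sub>R 1 + Im k *\<^sub>R \<i>)) = Re k *\<^sub>R ?D (L 1) + Im k *\<^sub>R ?D (L \<i>)"
        by (simp only: L.add L.scaleR D.add D.scaleR)
      ultimately have "?D (L k) = Re k *\<^sub>R ?D (L 1) + Im k *\<^sub>R ?D (L \<i>)"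
        by simp
      also have "\<dots> = ?D (L 1) * (of_real (Re k) + \<i> * of_real (Im k))"
        using CR[OF S] by (simp add: scaleR_conv_of_real algebra_simps)
      finally show "?D (L k) = ?D (L 1) * k"
        by (simp flip: complex_eq)
    qed
    have "((\<lambda>c. F ((p + s *\<^sub>R v) + L c)) has_derivative (\<lambda>k. ?D (L k))) (at c)"
      using D[OF S] by (intro has_derivative_along_line assms) (simp add: h_def algebra_simps)
    then have "((\<lambda>c. F ((p + s *\<^sub>R v) + L c)) has_derivative (*) (?D (L 1))) (at c)"
      unfolding lin .
    then have "((\<lambda>c. F (h (c, s))) has_field_derivative ?D (L 1)) (at c)"
      by (simp add: has_field_derivative_def h_def add_ac)
    then show "(\<lambda>c. F (h (c, s))) field_differentiable at c within ball 0 r"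
      using field_differentiable_def field_differentiable_at_within by blast
  qed
  \<comment> \<open>Step sizes of the difference quotients.\<close>
  define t where "t = (\<lambda>n. r / real (Suc n))"
  have t: "t n \<in> {0..r}" "t n > 0" for n
    using r by (auto simp: t_def field_simps)
  have t_lim: "t \<longlonglongrightarrow> 0"
    unfolding t_def using LIMSEQ_Suc[OF lim_const_over_n[of r]] by simp
  have "(\<lambda>c. \<psi> (c, 0)) holomorphic_on ball 0 r"
  proof (rule holomorphic_uniform_sequence[OF open_ball])
    show "(\<lambda>c. (F (h (c, t n)) - F (h (c, 0))) / of_real (t n)) holomorphic_on ball 0 r" for n
      using r t[of n] by (intro holomorphic_intros hol) auto
    have "uniform_limit (ball 0 r) (\<lambda>n c. (F (h (c, t n)) - F (h (c, 0))) / of_real (t n))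
      (\<lambda>c. \<psi> (c, 0)) sequentially"
    proof (rule uniform_limitI)
      fix \<epsilon> :: real assume "\<epsilon> > 0"
      then obtain \<delta> where \<delta>: "\<delta> > 0"
        "\<And>u u'. u \<in> cball 0 r \<times> {0..r} \<Longrightarrow> u' \<in> cball 0 r \<times> {0..r} \<Longrightarrow> dist u' u < \<delta> \<Longrightarrow>
          dist (\<psi> u') (\<psi> u) < \<epsilon> / 2"
        using uc unfolding uniformly_continuous_on_def by (meson half_gt_zero)
      have "\<forall>\<^sub>F n in sequentially. t n < \<delta>"
        using order_tendstoD(2)[OF t_lim] \<delta>(1) by blast
      then show "\<forall>\<^sub>F n in sequentially. \<forall>c\<in>ball 0 r.
        dist ((F (h (c, t n)) - F (h (c, 0))) / of_real (t n)) (\<psi> (c, 0)) < \<epsilon>"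
      proof (rule eventually_mono, intro ballI)
        fix n and c :: complex assume n: "t n < \<delta>" and c: "c \<in> ball 0 r"
        have "norm (F (h (c, t n)) - F (h (c, 0)) - (t n - 0) *\<^sub>R \<psi> (c, 0)) \<le> norm (t n - 0) * (\<epsilon> / 2)"
        proof (rule vector_differentiable_bound_linearization[where S = "{0..t n}"])
          fix s assume s: "s \<in> {0..t n}"
          then have s': "s \<in> {0..r}"
            using t(1)[of n] by simp
          have "((\<lambda>s. F ((p + L c) + s *\<^sub>R v)) has_derivative
              (\<lambda>k. frechet_derivative F (at (h (c, s))) (k *\<^sub>R v))) (at s)"
            using D[OF hS[of c s]] c s'
            by (intro has_derivative_along_line bounded_linear_scaleR_left) (simp add: h_def)
          moreover have "frechet_derivative F (at (h (c, s))) (k *\<^sub>R v) = k *\<^sub>R \<psi> (c, s)" for k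
            using D[OF hS[of c s]] c s' has_derivative_linear linear_cmul
            unfolding \<psi>_def by fastforce
          ultimately show "((\<lambda>s. F (h (c, s))) has_vector_derivative \<psi> (c, s)) (at s within {0..t n})"
            by (simp add: has_vector_derivative_def h_def has_derivative_at_withinI)
          have "dist (\<psi> (c, s)) (\<psi> (c, 0)) < \<epsilon> / 2"
            using c s s' r n by (intro \<delta>(2)) (auto simp: dist_Pair_Pair dist_real_def)
          then show "norm (\<psi> (c, s) - \<psi> (c, 0)) \<le> \<epsilon> / 2"
            by (simp add: dist_norm)
        qed (use t[of n] in \<open>auto simp: closed_segment_eq_real_ivl\<close>)
        then have bound: "norm (F (h (c, t n)) - F (h (c, 0)) - of_real (t n) * \<psi> (c, 0)) / t n \<le> \<epsilon> / 2"
          using t[of n] by (simp add: scaleR_conv_of_real field_simps)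
        have "(F (h (c, t n)) - F (h (c, 0))) / of_real (t n) - \<psi> (c, 0) =
            (F (h (c, t n)) - F (h (c, 0)) - of_real (t n) * \<psi> (c, 0)) / of_real (t n)"
          using t(2)[of n] by (simp add: field_simps)
        also have "norm \<dots> = norm (F (h (c, t n)) - F (h (c, 0)) - of_real (t n) * \<psi> (c, 0)) / t n"
          using t(2)[of n] by (simp add: norm_divide)
        finally have "dist ((F (h (c, t n)) - F (h (c, 0))) / of_real (t n)) (\<psi> (c, 0)) \<le> \<epsilon> / 2"
          using bound by (simp only: dist_norm)
        then show "dist ((F (h (c, t n)) - F (h (c, 0))) / of_real (t n)) (\<psi> (c, 0)) < \<epsilon>"
          using \<open>\<epsilon> > 0\<close> by linarith
      qed
    qed
    then show "\<exists>d>0. cball c d \<subseteq> ball 0 r \<and> uniform_limit (cball c d)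
        (\<lambda>n c. (F (h (c, t n)) - F (h (c, 0))) / of_real (t n)) (\<lambda>c. \<psi> (c, 0)) sequentially"
      if "c \<in> ball 0 r" for c
      using that open_contains_cball[of "ball 0 r"] uniform_limit_on_subset by blast
  qed
  then show thesis
    using that[OF r] by (simp add: \<psi>_def h_def)
qed

lemma has_wirtinger_holomorphic:
  assumes "(\<lambda>c. f (p + variable_line x c)) holomorphic_on ball 0 r" "r > 0"
  shows "has_wirtinger x f 0 p"
proof -
  obtain d where "((\<lambda>c. f (p + variable_line x c)) has_field_derivative d) (at 0)"
    using assms holomorphic_on_imp_differentiable_at[OF assms(1) open_ball, of 0]
    by (auto simp: field_differentiable_def)
  moreover have "0 = (d * 1 + \<i> * (d * \<i>)) / 2"
    by (simp add: algebra_simps)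
  ultimately show ?thesis
    unfolding has_wirtinger_def has_field_derivative_def by blast
qed

text \<open>This replaces the interchange of \<open>\<partial>\<^sub>x\<close> and \<open>\<partial>\<^sub>y\<close>, for which \<open>F\<close> is not smooth enough.\<close>

lemma has_wirtinger_wirtinger_0:
  fixes F :: "(complex ^ 'm) \<times> (complex ^ 'n) \<Rightarrow> complex"
  assumes "open S" "R_differentiable 1 F S" "\<And>q. q \<in> S \<Longrightarrow> wirtinger x F q = 0" "p \<in> S"
  shows "has_wirtinger x (wirtinger y F) 0 p"
proof -
  have F: "F differentiable_on S" "\<And>v. continuous_on S (\<lambda>p. frechet_derivative F (at p) v)"
    using assms(2) by auto
  have diff: "F differentiable at q" if "q \<in> S" for q
    using F(1) assms(1) that by (simp add: differentiable_on_eq_differentiable_at)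
  have CR: "frechet_derivative F (at q) (variable_line x \<i>) =
      \<i> * frechet_derivative F (at q) (variable_line x 1)" if "q \<in> S" for q
  proof -
    have "\<i> * (frechet_derivative F (at q) (variable_line x 1) +
      \<i> * frechet_derivative F (at q) (variable_line x \<i>)) = 0"
      using assms(3)[OF that] wirtinger_eq_dbar[OF diff[OF that], of x] by simp
    then show ?thesis
      by (simp add: algebra_simps)
  qed
  have D: "has_wirtinger x (\<lambda>q. frechet_derivative F (at q) v) 0 p" for v
  proof -
    obtain r where "r > 0"
      "(\<lambda>c. frechet_derivative F (at (p + variable_line x c)) v) holomorphic_on ball 0 r"
      by (rule holomorphic_directional_derivative[OF assms(1,4) bounded_linear_variable_line F CR])
    then show ?thesis
      by (rule has_wirtinger_holomorphic[rotated])
  qed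
  have "has_wirtinger x (\<lambda>q. 1 / 2 * frechet_derivative F (at q) (variable_line y 1) +
      \<i> / 2 * frechet_derivative F (at q) (variable_line y \<i>))
      ((0 * frechet_derivative F (at p) (variable_line y 1) + 1 / 2 * 0) +
      (0 * frechet_derivative F (at p) (variable_line y \<i>) + \<i> / 2 * 0)) p"
    by (intro has_wirtinger_add has_wirtinger_mult has_wirtinger_const D)
  then have "has_wirtinger x (\<lambda>q. 1 / 2 * frechet_derivative F (at q) (variable_line y 1) +
      \<i> / 2 * frechet_derivative F (at q) (variable_line y \<i>)) 0 p"
    by simp
  then show ?thesis
    by (rule has_wirtinger_transform[OF _ assms(1,4)])
      (simp only: wirtinger_eq_dbar[OF diff] add_divide_distrib times_divide_eq_left mult_1)
qed

section \<open>Vanishing of Wronskians\<close>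

text \<open>The vector \<open>a\<close> is a nonzero element of the kernel of the Wronskian matrix.\<close>

lemma wronskian_eq_0I:
  assumes "\<And>i. i < length us \<Longrightarrow> (\<Sum>k<length us. (wirtinger x ^^ i) (us ! k) p * a k) = 0"
    and "k0 < length us" "a k0 \<noteq> 0"
  shows "wronskian x us p = 0"
proof -
  let ?n = "length us"
  let ?A = "Matrix.mat ?n ?n (\<lambda>(i, k). (wirtinger x ^^ i) (us ! k) p)"
  let ?v = "Matrix.vec ?n a"
  have A: "?A \<in> carrier_mat ?n ?n"
    by simp
  have "?A *\<^sub>v ?v = 0\<^sub>v ?n"
    by (rule eq_vecI) (use assms(1) in \<open>auto simp: scalar_prod_def atLeast0LessThan\<close>)
  moreover have "?v \<noteq> 0\<^sub>v ?n"
  proof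
    assume "?v = 0\<^sub>v ?n"
    then have "vec_index ?v k0 = vec_index (0\<^sub>v ?n) k0"
      by (rule arg_cong)
    then show False
      using assms(2,3) by simp
  qed
  ultimately show ?thesis
    unfolding wronskian_def det_0_iff_vec_prod_zero[OF A]
    by (intro exI[of _ ?v]) simp
qed

text \<open>The \<open>\<phi> k\<close> behave as constants under \<open>\<partial>\<^sub>x\<close>, so that differentiating a linear relation with
  coefficients \<open>\<phi> k\<close> leaves these coefficients in place. The left hand side is zero on the open set
  \<open>S\<close>, hence its derivative along the line is zero as well.\<close>

lemma wirtinger_funpow_relation:
  fixes S :: "((complex ^ 'm) \<times> (complex ^ 'n)) set"
  assumes "open S"
    and u: "\<And>k. k \<in> K \<Longrightarrow> R_differentiable d (u k) S"
    and \<phi>: "\<And>k q. k \<in> K \<Longrightarrow> q \<in> S \<Longrightarrow> has_wirtinger x (\<phi> k) 0 q"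
    and rel: "\<And>q. q \<in> S \<Longrightarrow> (\<Sum>k\<in>K. u k q * \<phi> k q) = 0"
    and "i \<le> d" "p \<in> S"
  shows "(\<Sum>k\<in>K. (wirtinger x ^^ i) (u k) p * \<phi> k p) = 0"
  using assms(5,6)
proof (induction i arbitrary: p)
  case 0
  then show ?case using rel by simp
next
  case (Suc i)
  have "has_wirtinger x ((wirtinger x ^^ i) (u k)) ((wirtinger x ^^ Suc i) (u k) p) p"
    if "k \<in> K" for k
  proof -
    have "R_differentiable (d - i) ((wirtinger x ^^ i) (u k)) S"
      using Suc.prems by (intro R_differentiable_wirtinger_funpow assms that) simp
    moreover have "d - i = Suc (d - Suc i)"
      using Suc.prems by simp
    ultimately have "(wirtinger x ^^ i) (u k) differentiable at p"
      using assms(1) Suc.prems(2) by (simp add: differentiable_on_eq_differentiable_at)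
    then show ?thesis
      using differentiable_imp_has_wirtinger by simp
  qed
  then have "has_wirtinger x (\<lambda>q. \<Sum>k\<in>K. (wirtinger x ^^ i) (u k) q * \<phi> k q)
      (\<Sum>k\<in>K. (wirtinger x ^^ Suc i) (u k) p * \<phi> k p + (wirtinger x ^^ i) (u k) p * 0) p"
    using Suc.prems by (intro has_wirtinger_sum has_wirtinger_mult \<phi>)
  then have "has_wirtinger x (\<lambda>q. \<Sum>k\<in>K. (wirtinger x ^^ i) (u k) q * \<phi> k q)
      (\<Sum>k\<in>K. (wirtinger x ^^ Suc i) (u k) p * \<phi> k p) p"
    by (simp only: mult_zero_right add_0_right)
  moreover have "(\<Sum>k\<in>K. (wirtinger x ^^ i) (u k) q * \<phi> k q) = 0" if "q \<in> S" for q
    using Suc.IH[OF _ that] Suc.prems(1) by linarith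
  ultimately have "has_wirtinger x (\<lambda>_. 0) (\<Sum>k\<in>K. (wirtinger x ^^ Suc i) (u k) p * \<phi> k p) p"
    by (rule has_wirtinger_transform[OF _ assms(1) Suc.prems(2)])
  then show ?case
    using has_wirtinger_unique has_wirtinger_const by blast
qed

lemma wronskian_eq_0_of_relation:
  fixes S :: "((complex ^ 'm) \<times> (complex ^ 'n)) set"
  assumes "open S" "length us \<le> Suc d"
    and u: "\<And>u. u \<in> set us \<Longrightarrow> R_differentiable d u S"
    and \<phi>: "\<And>k q. k < length us \<Longrightarrow> q \<in> S \<Longrightarrow> has_wirtinger x (\<phi> k) 0 q"
    and rel: "\<And>q. q \<in> S \<Longrightarrow> (\<Sum>k<length us. (us ! k) q * \<phi> k q) = 0"
    and "p \<in> S" "k0 < length us" "\<phi> k0 p \<noteq> 0"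
  shows "wronskian x us p = 0"
proof (rule wronskian_eq_0I)
  show "(\<Sum>k<length us. (wirtinger x ^^ i) (us ! k) p * \<phi> k p) = 0" if "i < length us" for i
    using assms that by (intro wirtinger_funpow_relation[where d = d and S = S]) auto
qed fact+

lemma continuous_on_wronskian:
  fixes S :: "((complex ^ 'm) \<times> (complex ^ 'n)) set"
  assumes "open S" "length us \<le> Suc d" "\<And>u. u \<in> set us \<Longrightarrow> R_differentiable d u S"
  shows "continuous_on S (wronskian x us)"
proof -
  let ?n = "length us"
  have c: "continuous_on S ((wirtinger x ^^ i) (us ! k))" if "i < ?n" "k < ?n" for i k
    using assms that
    by (intro R_differentiable_imp_continuous_on[where k = "d - i"] R_differentiable_wirtinger_funpow) auto
  have eq: "wronskian x us = (\<lambda>p. \<Sum>\<pi> | \<pi> permutes {0..<?n}.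
      signof \<pi> * (\<Prod>i = 0..<?n. (wirtinger x ^^ i) (us ! \<pi> i) p))"
    unfolding wronskian_def fun_eq_iff
    by (intro allI, subst det_def'[of _ ?n]) (auto intro!: sum.cong prod.cong simp: permutes_in_image)
  show ?thesis
    unfolding eq
    by (intro continuous_on_sum continuous_on_mult continuous_on_prod continuous_on_const c)
      (auto simp: permutes_in_image)
qed

lemma zero_on_closure:
  fixes f :: "'a::topological_space \<Rightarrow> 'b::t1_space"
  assumes "continuous_on S f" "A \<subseteq> S" "\<And>p. p \<in> A \<Longrightarrow> f p = c" "p \<in> S \<inter> closure A"
  shows "f p = c"
proof -
  have "closedin (top_of_set S) {q \<in> S. f q = c}"
    by (rule continuous_closedin_preimage_constant[OF assms(1)])
  then obtain T where T: "closed T" "{q \<in> S. f q = c} = S \<inter> T"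
    unfolding closedin_closed by blast
  then have "A \<subseteq> T"
    using assms(2,3) by blast
  then have "closure A \<subseteq> T"
    using T(1) closure_minimal by blast
  then show ?thesis
    using assms(4) T(2) by blast
qed

lemma wronskian_eq_0_on_closure:
  fixes G S :: "((complex ^ 'm) \<times> (complex ^ 'n)) set"
  assumes "open G" "open S" "S \<subseteq> G" "length us \<le> Suc d"
    and u: "\<And>u. u \<in> set us \<Longrightarrow> R_differentiable d u G"
    and \<phi>: "\<And>k q. k < length us \<Longrightarrow> q \<in> S \<Longrightarrow> has_wirtinger x (\<phi> k) 0 q"
    and rel: "\<And>q. q \<in> S \<Longrightarrow> (\<Sum>k<length us. (us ! k) q * \<phi> k q) = 0"
    and "N \<subseteq> S" "\<And>q. q \<in> N \<Longrightarrow> \<exists>k<length us. \<phi> k q \<noteq> 0" "p \<in> G \<inter> closure N"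
  shows "wronskian x us p = 0"
proof (rule zero_on_closure[where f = "wronskian x us" and S = G and A = N])
  show "continuous_on G (wronskian x us)"
    by (rule continuous_on_wronskian[OF assms(1,4) u])
  show "wronskian x us q = 0" if q: "q \<in> N" for q
  proof -
    obtain k where "k < length us" "\<phi> k q \<noteq> 0"
      using assms(9)[OF q] by blast
    then show ?thesis
      using q assms(8) R_differentiable_subset[OF u assms(3)]
      by (intro wronskian_eq_0_of_relation[OF assms(2,4) _ \<phi> rel]) auto
  qed
qed (use assms in auto)

section \<open>The first integral\<close>

lemma nth_index_surj:
  obtains k where "k \<in> {1..CARD('a)}" "nth_index k = (i :: 'a::finite)"
proof -
  obtain k where k: "k < CARD('a)" "from_nat_into UNIV k = i"
    using bij_betw_from_nat_into_finite[of "UNIV :: 'a set"]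
    by (metis finite bij_betw_def UNIV_I imageE lessThan_iff)
  then show thesis
    by (intro that[of "Suc k"]) (auto simp: nth_index_def)
qed

text \<open>The derivatives in a variable and in its conjugate together determine the two real partial
  derivatives, and the real directions belonging to all \<open>z\<close> and \<open>w\<close> span the space.\<close>

lemma frechet_derivative_eq_0I:
  fixes F :: "(complex ^ 'm) \<times> (complex ^ 'n) \<Rightarrow> complex"
  assumes "F differentiable at p"
    and z: "\<And>i. i \<in> {1..CARD('m)} \<Longrightarrow> wirtinger (Z i) F p = 0 \<and> wirtinger (Zbar i) F p = 0"
    and w: "\<And>i. i \<in> {1..CARD('n)} \<Longrightarrow> wirtinger (W i) F p = 0 \<and> wirtinger (Wbar i) F p = 0"
  shows "frechet_derivative F (at p) = (\<lambda>v. 0)"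
proof
  fix v :: "(complex ^ 'm) \<times> (complex ^ 'n)"
  let ?D = "frechet_derivative F (at p)"
  interpret D: bounded_linear ?D
    by (rule bounded_linear_frechet_derivative[OF assms(1)])
  have zero: "?D (variable_vec x c) = 0"
    if "?D (variable_vec x 1) = 0" "?D (variable_vec x \<i>) = 0" for x c
  proof -
    interpret V: bounded_linear "variable_vec x :: complex \<Rightarrow> (complex ^ 'm) \<times> (complex ^ 'n)"
      by (rule bounded_linear_variable_vec)
    have "?D (variable_vec x (Re c *\<^sub>R 1 + Im c *\<^sub>R \<i>)) = 0"
      by (simp only: V.add V.scaleR D.add D.scaleR that) simp
    moreover have "Re c *\<^sub>R 1 + Im c *\<^sub>R \<i> = c"
      by (simp add: complex_eq_iff)
    ultimately show ?thesis
      by simp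
  qed
  have cancel: "a = 0" "b = 0" if "a - \<i> * b = 0" "a + \<i> * b = 0" for a b :: complex
  proof -
    have "(a - \<i> * b) + (a + \<i> * b) = 2 * a"
      by (simp add: algebra_simps)
    then show "a = 0"
      using that by simp
    then show "b = 0"
      using that(2) by simp
  qed
  have 1: "?D (axis i c, 0) = 0" for i c
  proof -
    obtain k where k: "k \<in> {1..CARD('m)}" "nth_index k = i"
      by (rule nth_index_surj)
    have minus: "?D (axis i 1, 0) - \<i> * ?D (axis i \<i>, 0) = 0"
      using conjunct1[OF z[OF k(1)]] by (simp add: wirtinger_def Let_def k(2))
    have plus: "?D (axis i 1, 0) + \<i> * ?D (axis i \<i>, 0) = 0"
      using conjunct2[OF z[OF k(1)]] by (simp add: wirtinger_def Let_def k(2))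
    have "?D (variable_vec (Z k) c) = 0"
      by (rule zero) (simp_all add: k(2) cancel[OF minus plus])
    then show ?thesis by (simp add: k(2))
  qed
  have 2: "?D (0, axis i c) = 0" for i c
  proof -
    obtain k where k: "k \<in> {1..CARD('n)}" "nth_index k = i"
      by (rule nth_index_surj)
    have minus: "?D (0, axis i 1) - \<i> * ?D (0, axis i \<i>) = 0"
      using conjunct1[OF w[OF k(1)]] by (simp add: wirtinger_def Let_def k(2))
    have plus: "?D (0, axis i 1) + \<i> * ?D (0, axis i \<i>) = 0"
      using conjunct2[OF w[OF k(1)]] by (simp add: wirtinger_def Let_def k(2))
    have "?D (variable_vec (W k) c) = 0"
      by (rule zero) (simp_all add: k(2) cancel[OF minus plus])
    then show ?thesis by (simp add: k(2))
  qed
  have "v = (\<Sum>i\<in>UNIV. (axis i (vec_nth (fst v) i), 0)) + (\<Sum>i\<in>UNIV. (0, axis i (vec_nth (snd v) i)))"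
    by (auto simp: prod_eq_iff Finite_Cartesian_Product.vec_eq_iff fst_sum snd_sum axis_def if_distrib cong: if_cong)
  then have "?D v = (\<Sum>i\<in>UNIV. ?D (axis i (vec_nth (fst v) i), 0)) + (\<Sum>i\<in>UNIV. ?D (0, axis i (vec_nth (snd v) i)))"
    by (metis D.add D.sum)
  then show "?D v = 0"
    by (simp add: 1 2)
qed

text \<open>The order of the entries matches that of \<open>coeff_vector\<close>.\<close>

definition w_gradient ::
  "((complex ^ 'm) \<times> (complex ^ 'n) \<Rightarrow> complex) \<Rightarrow> nat \<Rightarrow> nat \<Rightarrow> (nat \<Rightarrow> nat) \<Rightarrow>
   ((complex ^ 'm) \<times> (complex ^ 'n) \<Rightarrow> complex) list" where
  "w_gradient F k1 k2 \<zeta> =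
     map (\<lambda>\<xi>. wirtinger (W \<xi>) F) [1..<Suc k1] @ map (\<lambda>\<delta>. wirtinger (Wbar (\<zeta> \<delta>)) F) [1..<Suc k2]"

lemma length_w_gradient [simp]: "length (w_gradient F k1 k2 \<zeta>) = k1 + k2"
  by (simp add: w_gradient_def)

lemma set_w_gradient:
  "set (w_gradient F k1 k2 \<zeta>) =
    (\<lambda>\<xi>. wirtinger (W \<xi>) F) ` {1..k1} \<union> (\<lambda>\<delta>. wirtinger (Wbar (\<zeta> \<delta>)) F) ` {1..k2}"
  by (simp only: w_gradient_def set_append set_map set_upt atLeastLessThanSuc_atLeastAtMost)

lemma length_coeff_vector [simp]: "length (coeff_vector X k1 k2 \<zeta> l) = k1 + k2"
  by (simp add: coeff_vector_def)

lemma sum_lessThan_add: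
  "(\<Sum>k<a + b. f k) = (\<Sum>k<a. f k) + (\<Sum>k<b. f (a + k))" for f :: "nat \<Rightarrow> 'a::comm_monoid_add"
  by (induction b) (auto simp: add.assoc)

text \<open>The terms with the derivatives in the absent variables among the \<open>w\<close> and their conjugates drop
  out. The conjugate terms are first reordered along \<open>\<zeta>\<close>.\<close>

lemma system_operator_eq:
  fixes F :: "(complex ^ 'm) \<times> (complex ^ 'n) \<Rightarrow> complex"
  assumes "k1 \<le> CARD('n)" "k2 \<le> CARD('n)" "\<zeta> permutes {1..CARD('n)}"
    and "\<And>\<gamma>. \<gamma> \<in> {k1<..CARD('n)} \<Longrightarrow> wirtinger (W \<gamma>) F p = 0"
    and "\<And>\<delta>. \<delta> \<in> {k2<..CARD('n)} \<Longrightarrow> wirtinger (Wbar (\<zeta> \<delta>)) F p = 0"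
  shows "system_operator X l F p = wirtinger (differential CARD('m) l) F p +
    (\<Sum>k<k1 + k2. (coeff_vector X k1 k2 \<zeta> l ! k) p * (w_gradient F k1 k2 \<zeta> ! k) p)"
proof -
  define f where "f = (\<lambda>\<xi>. X \<xi> l p * wirtinger (W \<xi>) F p)"
  define g where "g = (\<lambda>\<xi>. cnj (X \<xi> (conj_index CARD('m) l) p) * wirtinger (Wbar \<xi>) F p)"
  have "(\<Sum>\<xi> = 1..CARD('n). f \<xi>) = (\<Sum>\<xi> = 1..k1. f \<xi>)"
    using assms(1,4) by (intro sum.mono_neutral_right) (auto simp: f_def)
  moreover have "(\<Sum>\<xi> = 1..CARD('n). g \<xi>) = (\<Sum>\<delta> = 1..CARD('n). g (\<zeta> \<delta>))"
    using sum.permute[OF assms(3), of g] by (simp add: o_def)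
  moreover have "\<dots> = (\<Sum>\<delta> = 1..k2. g (\<zeta> \<delta>))"
    using assms(2,5) by (intro sum.mono_neutral_right) (auto simp: g_def)
  moreover have "(\<Sum>k<k1 + k2. (coeff_vector X k1 k2 \<zeta> l ! k) p * (w_gradient F k1 k2 \<zeta> ! k) p) =
      (\<Sum>\<xi> = 1..k1. f \<xi>) + (\<Sum>\<delta> = 1..k2. g (\<zeta> \<delta>))"
    unfolding sum_lessThan_add One_nat_def sum.atLeast1_atMost_eq
    by (auto simp: coeff_vector_def w_gradient_def nth_append f_def g_def simp del: upt_Suc)
  ultimately show ?thesis
    by (simp add: system_operator_def sum.distrib f_def g_def)
qed

lemma R_differentiable_coeff_vector:
  fixes X :: "nat \<Rightarrow> nat \<Rightarrow> (complex ^ 'm) \<times> (complex ^ 'n) \<Rightarrow> complex"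
  assumes "open S" "k1 \<le> CARD('n)" "k2 \<le> CARD('n)" "\<zeta> permutes {1..CARD('n)}"
    and "\<And>\<xi> l. \<xi> \<in> {1..CARD('n)} \<Longrightarrow> l \<in> {1..2 * CARD('m)} \<Longrightarrow> R_differentiable d (X \<xi> l) S"
    and "l \<in> {1..2 * CARD('m)}" "u \<in> set (coeff_vector X k1 k2 \<zeta> l)"
  shows "R_differentiable d u S"
proof -
  have l': "conj_index CARD('m) l \<in> {1..2 * CARD('m)}"
    using assms(6) by (auto simp: conj_index_def)
  from assms(7) consider \<xi> where "\<xi> \<in> {1..k1}" "u = X \<xi> l"
    | \<delta> where "\<delta> \<in> {1..k2}" "u = (\<lambda>p. cnj (X (\<zeta> \<delta>) (conj_index CARD('m) l) p))"
    by (fastforce simp: coeff_vector_def)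
  then show ?thesis
  proof cases
    case 1
    then show ?thesis using assms by auto
  next
    case 2
    have "\<zeta> \<delta> \<in> {1..CARD('n)}"
      using 2 assms(3) permutes_in_image[OF assms(4)] by auto
    then show ?thesis
      unfolding 2 using assms(5) l' by (intro R_differentiable_bounded_linear[OF assms(1) bounded_linear_cnj])
  qed
qed

text \<open>Were all entries of \<open>w_gradient\<close> zero, then all derivatives in the \<open>w\<close> and their conjugates would
  be, and each equation of the system would reduce to the vanishing of one derivative in a \<open>z\<close> or
  its conjugate.\<close>

lemma w_gradient_nonzero:
  fixes F :: "(complex ^ 'm) \<times> (complex ^ 'n) \<Rightarrow> complex"
  assumes "k1 \<le> CARD('n)" "k2 \<le> CARD('n)" "\<zeta> permutes {1..CARD('n)}"
    and W: "\<And>\<gamma>. \<gamma> \<in> {k1<..CARD('n)} \<Longrightarrow> wirtinger (W \<gamma>) F p = 0"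
    and Wbar: "\<And>\<delta>. \<delta> \<in> {k2<..CARD('n)} \<Longrightarrow> wirtinger (Wbar (\<zeta> \<delta>)) F p = 0"
    and sys: "\<And>l. l \<in> {1..2 * CARD('m)} \<Longrightarrow> system_operator X l F p = 0"
    and "F differentiable at p" "frechet_derivative F (at p) \<noteq> (\<lambda>v. 0)"
  obtains k where "k < k1 + k2" "(w_gradient F k1 k2 \<zeta> ! k) p \<noteq> 0"
proof (rule ccontr)
  assume "\<not> thesis"
  then have 0: "\<forall>k < k1 + k2. (w_gradient F k1 k2 \<zeta> ! k) p = 0"
    using that by blast
  then have "\<forall>f \<in> set (w_gradient F k1 k2 \<zeta>). f p = 0"
    by (metis in_set_conv_nth length_w_gradient)
  then have low: "\<forall>\<xi> \<in> {1..k1}. wirtinger (W \<xi>) F p = 0"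
      "\<forall>\<delta> \<in> {1..k2}. wirtinger (Wbar (\<zeta> \<delta>)) F p = 0"
    unfolding set_w_gradient by blast+
  have w: "wirtinger (W i) F p = 0 \<and> wirtinger (Wbar i) F p = 0" if i: "i \<in> {1..CARD('n)}" for i
  proof -
    obtain \<delta> where "\<delta> \<in> {1..CARD('n)}" "i = \<zeta> \<delta>"
      using i permutes_image[OF assms(3)] by blast
    then show ?thesis
      using W[of i] Wbar[of \<delta>] low i by (cases "i \<le> k1"; cases "\<delta> \<le> k2") auto
  qed
  have d: "wirtinger (differential CARD('m) l) F p = 0" if "l \<in> {1..2 * CARD('m)}" for l
    using sys[OF that] w by (simp add: system_operator_def)
  have "wirtinger (Z i) F p = 0 \<and> wirtinger (Zbar i) F p = 0" if "i \<in> {1..CARD('m)}" for i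
    using d[of i] d[of "CARD('m) + i"] that by (simp add: differential_def)
  then show False
    using frechet_derivative_eq_0I[OF assms(7) _ w] assms(8) by blast
qed

theorem theorem1p6:
  fixes G G' :: "((complex ^ 'm) \<times> (complex ^ 'n)) set"
    and X :: "nat \<Rightarrow> nat \<Rightarrow> (complex ^ 'm) \<times> (complex ^ 'n) \<Rightarrow> complex"
    and F :: "(complex ^ 'm) \<times> (complex ^ 'n) \<Rightarrow> complex"
    and s1 s2 k1 k2 :: nat
    and j \<zeta> :: "nat \<Rightarrow> nat"
  assumes "open G" "connected G"
    and "open G'" "connected G'" "G' \<noteq> {}" "G' \<subseteq> G"
    and "\<And>\<xi> l. \<xi> \<in> {1..CARD('n)} \<Longrightarrow> l \<in> {1..2 * CARD('m)} \<Longrightarrow> R_differentiable (k1 + k2) (X \<xi> l) G"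
    and "s1 \<le> CARD('m)" "s2 \<le> CARD('m)" "k1 \<le> CARD('n)" "k2 \<le> CARD('n)"
    and "j permutes {1..CARD('m)}" "\<zeta> permutes {1..CARD('n)}"
    and "first_integral X G' F"
    and "cylindricality s1 s2 k1 k2 j \<zeta> G' F"
  shows "\<forall>x \<in> absent_variables CARD('m) CARD('n) s1 s2 k1 k2 j \<zeta>.
    \<forall>p \<in> G \<inter> closure (noncritical_points F G').
      (\<forall>\<theta> \<in> {1..s1}. wronskian x ((\<lambda>_. 1) # coeff_vector X k1 k2 \<zeta> \<theta>) p = 0) \<and>
      (\<forall>\<eta> \<in> {s1<..CARD('m)}. wronskian x (coeff_vector X k1 k2 \<zeta> \<eta>) p = 0) \<and>
      (\<forall>g \<in> {1..s2}. wronskian x ((\<lambda>_. 1) # coeff_vector X k1 k2 \<zeta> (CARD('m) + j g)) p = 0) \<and>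
      (\<forall>\<nu> \<in> {s2<..CARD('m)}. wronskian x (coeff_vector X k1 k2 \<zeta> (CARD('m) + j \<nu>)) p = 0)"
proof (intro ballI)
  fix x p
  assume x: "x \<in> absent_variables CARD('m) CARD('n) s1 s2 k1 k2 j \<zeta>"
    and p: "p \<in> G \<inter> closure (noncritical_points F G')"
  let ?N = "noncritical_points F G'"
  let ?\<psi> = "w_gradient F k1 k2 \<zeta>"
  have F: "R_differentiable 1 F G'"
    and sys: "\<And>l q. l \<in> {1..2 * CARD('m)} \<Longrightarrow> q \<in> G' \<Longrightarrow> system_operator X l F q = 0"
    using assms(14) by (auto simp: first_integral_def)
  have absent: "wirtinger y F q = 0"
    if "y \<in> absent_variables CARD('m) CARD('n) s1 s2 k1 k2 j \<zeta>" "q \<in> G'" for y q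
    using assms(15) that by (auto simp: cylindricality_def)
  have W: "wirtinger (W \<gamma>) F q = 0" if "\<gamma> \<in> {k1<..CARD('n)}" "q \<in> G'" for \<gamma> q
    using that by (intro absent) (auto simp: absent_variables_def)
  have Wbar: "wirtinger (Wbar (\<zeta> \<delta>)) F q = 0" if "\<delta> \<in> {k2<..CARD('n)}" "q \<in> G'" for \<delta> q
    using that by (intro absent) (auto simp: absent_variables_def)
  have inv: "has_wirtinger x (wirtinger y F) 0 q" if "q \<in> G'" for y q
    using has_wirtinger_wirtinger_0[OF assms(3) F absent[OF x] that] .
  have inv\<psi>: "has_wirtinger x (?\<psi> ! k) 0 q" if "k < k1 + k2" "q \<in> G'" for k q
  proof -
    have "?\<psi> ! k \<in> set ?\<psi>"
      using that by simp
    then obtain y where "?\<psi> ! k = wirtinger y F"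
      unfolding set_w_gradient by blast
    then show ?thesis
      using inv[OF that(2)] by simp
  qed
  have rel: "wirtinger (differential CARD('m) l) F q +
      (\<Sum>k<k1 + k2. (coeff_vector X k1 k2 \<zeta> l ! k) q * (?\<psi> ! k) q) = 0"
    if "l \<in> {1..2 * CARD('m)}" "q \<in> G'" for l q
    using system_operator_eq[OF assms(10,11,13) W Wbar, OF _ that(2) _ that(2)] sys[OF that] by metis
  have NG: "?N \<subseteq> G'"
    by (auto simp: noncritical_points_def)
  have nonzero: "\<exists>k < k1 + k2. (?\<psi> ! k) q \<noteq> 0" if "q \<in> ?N" for q
  proof -
    have "q \<in> G'" "frechet_derivative F (at q) \<noteq> (\<lambda>v. 0)"
      using that by (auto simp: noncritical_points_def)
    moreover have "F differentiable at q"
      using F \<open>q \<in> G'\<close> assms(3) by (simp add: differentiable_on_eq_differentiable_at)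
    ultimately show ?thesis
      using w_gradient_nonzero[OF assms(10,11,13) W Wbar sys] by metis
  qed
  have smooth: "R_differentiable (k1 + k2) u G"
    if "l \<in> {1..2 * CARD('m)}" "u \<in> set ((\<lambda>_. 1) # coeff_vector X k1 k2 \<zeta> l)" for l u
    using R_differentiable_coeff_vector[OF assms(1,10,11,13,7) that(1)] that(2)
      R_differentiable_const by auto
  have with_1: "wronskian x ((\<lambda>_. 1) # coeff_vector X k1 k2 \<zeta> l) p = 0"
    if l: "l \<in> {1..2 * CARD('m)}" for l
  proof -
    \<comment> \<open>The entry \<open>1\<close> takes up the derivative in the variable number \<open>l\<close>, as the coefficient of that
      derivative in the relation.\<close>
    let ?us = "(\<lambda>_. 1) # coeff_vector X k1 k2 \<zeta> l"
    let ?\<phi>s = "wirtinger (differential CARD('m) l) F # ?\<psi>"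
    have inv_k: "has_wirtinger x (?\<phi>s ! k) 0 q" if "k < length ?us" "q \<in> G'" for k q
      using that inv inv\<psi> by (cases k) auto
    have rel0: "(\<Sum>k<length ?us. (?us ! k) q * (?\<phi>s ! k) q) = 0" if "q \<in> G'" for q
      using rel[OF l that] by (simp add: sum.lessThan_Suc_shift del: sum.lessThan_Suc)
    have nonzero0: "\<exists>k<length ?us. (?\<phi>s ! k) q \<noteq> 0" if q: "q \<in> ?N" for q
    proof -
      obtain k where "k < k1 + k2" "(?\<psi> ! k) q \<noteq> 0"
        using nonzero[OF q] by blast
      then show ?thesis
        by (intro exI[of _ "Suc k"]) simp
    qed
    show ?thesis
      by (rule wronskian_eq_0_on_closure[OF assms(1,3,6) _ smooth[OF l] inv_k rel0 NG nonzero0 p])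
        simp_all
  qed
  have without_1: "wronskian x (coeff_vector X k1 k2 \<zeta> l) p = 0"
    if l: "l \<in> {1..2 * CARD('m)}"
      and y: "differential CARD('m) l \<in> absent_variables CARD('m) CARD('n) s1 s2 k1 k2 j \<zeta>" for l
  proof -
    let ?us = "coeff_vector X k1 k2 \<zeta> l"
    have inv_k: "has_wirtinger x (?\<psi> ! k) 0 q" if "k < length ?us" "q \<in> G'" for k q
      using that inv\<psi> by simp
    have rel0: "(\<Sum>k<length ?us. (?us ! k) q * (?\<psi> ! k) q) = 0" if "q \<in> G'" for q
      using rel[OF l that] absent[OF y that] by simp
    have nonzero0: "\<exists>k<length ?us. (?\<psi> ! k) q \<noteq> 0" if "q \<in> ?N" for q
      using nonzero[OF that] by simp
    show ?thesis
      by (rule wronskian_eq_0_on_closure[OF assms(1,3,6) _ smooth[OF l] inv_k rel0 NG nonzero0 p])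
        simp_all
  qed
  have j: "j i \<in> {1..CARD('m)}" if "i \<in> {1..CARD('m)}" for i
    using permutes_in_image[OF assms(12)] that by simp
  show "(\<forall>\<theta> \<in> {1..s1}. wronskian x ((\<lambda>_. 1) # coeff_vector X k1 k2 \<zeta> \<theta>) p = 0) \<and>
      (\<forall>\<eta> \<in> {s1<..CARD('m)}. wronskian x (coeff_vector X k1 k2 \<zeta> \<eta>) p = 0) \<and>
      (\<forall>g \<in> {1..s2}. wronskian x ((\<lambda>_. 1) # coeff_vector X k1 k2 \<zeta> (CARD('m) + j g)) p = 0) \<and>
      (\<forall>\<nu> \<in> {s2<..CARD('m)}. wronskian x (coeff_vector X k1 k2 \<zeta> (CARD('m) + j \<nu>)) p = 0)"
  proof (intro conjI ballI)
    fix \<theta> assume "\<theta> \<in> {1..s1}"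
    then show "wronskian x ((\<lambda>_. 1) # coeff_vector X k1 k2 \<zeta> \<theta>) p = 0"
      using assms(8) by (intro with_1) auto
  next
    fix \<eta> assume "\<eta> \<in> {s1<..CARD('m)}"
    then show "wronskian x (coeff_vector X k1 k2 \<zeta> \<eta>) p = 0"
      by (intro without_1) (auto simp: differential_def absent_variables_def)
  next
    fix g assume "g \<in> {1..s2}"
    then show "wronskian x ((\<lambda>_. 1) # coeff_vector X k1 k2 \<zeta> (CARD('m) + j g)) p = 0"
      using assms(9) j[of g] by (intro with_1) auto
  next
    fix \<nu> assume "\<nu> \<in> {s2<..CARD('m)}"
    then show "wronskian x (coeff_vector X k1 k2 \<zeta> (CARD('m) + j \<nu>)) p = 0"
      using j[of \<nu>] by (intro without_1) (auto simp: differential_def absent_variables_def)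
  qed
qed

end
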